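(* Let $T:V\to\mathfrak g$ be a relative Rota-Baxter operator on a Lie-Yamaguti algebra $(\mathfrak g,[\cdot,\cdot],[\![\cdot,\cdot,\cdot]\!])$ (over a field of characteristic $0$) with respect to a representation $(V;\rho,\mu)$, and let $(V,[\cdot,\cdot]_T,[\![\cdot,\cdot,\cdot]\!]_T)$ be its sub-adjacent Lie-Yamaguti algebra. Define $\varrho:V\to\mathfrak{gl}(\mathfrak g)$ and $\varpi:\otimes^2V\to\mathfrak{gl}(\mathfrak g)$ by, for $u,v\in V$, $x\in\mathfrak g$, $$\varrho(u)x=[Tu,x]+T(\rho(x)u),\qquad \varpi(u,v)x=[\![x,Tu,Tv]\!]-T\big(D_{\rho,\mu}(x,Tu)v-\mu(x,Tv)u\big).$$ Then $(\mathfrak g;\varrho,\varpi)$ is a representation of the sub-adjacent Lie-Yamaguti algebra $(V,[\cdot,\cdot]_T,[\![\cdot,\cdot,\cdot]\!]_T)$, with $$D_{\varrho,\varpi}(u,v)x=[\![Tu,Tv,x]\!]-T\big(\mu(Tv,x)u-\mu(Tu,x)v\big).$$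
   Context: Lie-Yamaguti algebra: a vector space $\mathfrak g$ with a bilinear bracket $[\cdot,\cdot]:\wedge^2\mathfrak g\to\mathfrak g$ and a trilinear bracket $[\![\cdot,\cdot,\cdot]\!]:\wedge^2\mathfrak g\otimes\mathfrak g\to\mathfrak g$ such that for all $x,y,z,w,t\in\mathfrak g$: (1) $[[x,y],z]+[[y,z],x]+[[z,x],y]+[\![x,y,z]\!]+[\![y,z,x]\!]+[\![z,x,y]\!]=0$; (2) $[\![[x,y],z,w]\!]+[\![[y,z],x,w]\!]+[\![[z,x],y,w]\!]=0$; (3) $[\![x,y,[z,w]]\!]=[[\![x,y,z]\!],w]+[z,[\![x,y,w]\!]]$; (4) $[\![x,y,[\![z,w,t]\!]]\!]=[\![[\![x,y,z]\!],w,t]\!]+[\![z,[\![x,y,w]\!],t]\!]+[\![z,w,[\![x,y,t]\!]]\!]$. Representation $(V;\rho,\mu)$ of a Lie-Yamaguti algebra $\mathfrak g$: a vector space $V$ with linear maps $\rho:\mathfrak g\to\mathfrak{gl}(V)$, $\mu:\otimes^2\mathfrak g\to\mathfrak{gl}(V)$ such that, with $D(x,y)=D_{\rho,\mu}(x,y):=\mu(y,x)-\mu(x,y)+[\rho(x),\rho(y)]-\rho([x,y])$, for all $x,y,z,w\in\mathfrak g$: $\mu([x,y],z)-\mu(x,z)\rho(y)+\mu(y,z)\rho(x)=0$; $\mu(x,[y,z])-\rho(y)\mu(x,z)+\rho(z)\mu(x,y)=0$; $\rho([\![x,y,z]\!])=[D(x,y),\rho(z)]$; $\mu(z,w)\mu(x,y)-\mu(y,w)\mu(x,z)-\mu(x,[\![y,z,w]\!])+D(y,z)\mu(x,w)=0$;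 $\mu([\![x,y,z]\!],w)+\mu(z,[\![x,y,w]\!])=[D(x,y),\mu(z,w)]$. Relative Rota-Baxter operator on $\mathfrak g$ with respect to $(V;\rho,\mu)$: a linear map $T:V\to\mathfrak g$ with, for all $u,v,w\in V$, $[Tu,Tv]=T(\rho(Tu)v-\rho(Tv)u)$ and $[\![Tu,Tv,Tw]\!]=T(D_{\rho,\mu}(Tu,Tv)w+\mu(Tv,Tw)u-\mu(Tu,Tw)v)$. Sub-adjacent Lie-Yamaguti algebra of $T$: the vector space $V$ with $[u,v]_T=\rho(Tu)v-\rho(Tv)u$ and $[\![u,v,w]\!]_T=D_{\rho,\mu}(Tu,Tv)w+\mu(Tv,Tw)u-\mu(Tu,Tw)v$; it is known that this is a Lie-Yamaguti algebra. $D_{\varrho,\varpi}$ is defined from $(\varrho,\varpi)$ and $[\cdot,\cdot]_T$ as $D_{\varrho,\varpi}(u,v)=\varpi(v,u)-\varpi(u,v)+[\varrho(u),\varrho(v)]-\varrho([u,v]_T)$. *)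

theory Defs
  imports Complex_Main
begin

text \<open>
  Vector spaces are whole types with an explicit scalar multiplication, as in the locale
  \<^locale>\<open>vector_space\<close>.  Elements of \<open>gl(V)\<close> are functions on \<open>V\<close> satisfying
  \<open>Vector_Spaces.linear\<close>; a map out of a tensor product is a curried function that is linear in
  each argument; a map out of an exterior square is moreover alternating.
\<close>

definition gl_bracket :: "('v \<Rightarrow> 'v) \<Rightarrow> ('v \<Rightarrow> 'v) \<Rightarrow> 'v \<Rightarrow> 'v::ab_group_add" where
  "gl_bracket A B = (\<lambda>v. A (B v) - B (A v))"

locale lie_yamaguti_algebra = vector_space scale
  for scale :: "'k::field \<Rightarrow> 'g::ab_group_add \<Rightarrow> 'g" +
  fixes br :: "'g \<Rightarrow> 'g \<Rightarrow> 'g"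
    and tr :: "'g \<Rightarrow> 'g \<Rightarrow> 'g \<Rightarrow> 'g"
  assumes br_linear1: "Vector_Spaces.linear scale scale (\<lambda>x. br x y)"
    and br_linear2: "Vector_Spaces.linear scale scale (\<lambda>y. br x y)"
    and br_alt: "br x x = 0"
    and tr_linear1: "Vector_Spaces.linear scale scale (\<lambda>x. tr x y z)"
    and tr_linear2: "Vector_Spaces.linear scale scale (\<lambda>y. tr x y z)"
    and tr_linear3: "Vector_Spaces.linear scale scale (\<lambda>z. tr x y z)"
    and tr_alt: "tr x x z = 0"
    and LY1: "br (br x y) z + br (br y z) x + br (br z x) y
                + tr x y z + tr y z x + tr z x y = 0"
    and LY2: "tr (br x y) z w + tr (br y z) x w + tr (br z x) y w = 0"
    and LY3: "tr x y (br z w) = br (tr x y z) w + br z (tr x y w)"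
    and LY4: "tr x y (tr z w t) = tr (tr x y z) w t + tr z (tr x y w) t + tr z w (tr x y t)"

definition ly_D ::
  "('g \<Rightarrow> 'g \<Rightarrow> 'g) \<Rightarrow> ('g \<Rightarrow> 'v \<Rightarrow> 'v) \<Rightarrow> ('g \<Rightarrow> 'g \<Rightarrow> 'v \<Rightarrow> 'v) \<Rightarrow> 'g \<Rightarrow> 'g \<Rightarrow> 'v \<Rightarrow> 'v::ab_group_add" where
  "ly_D br \<rho> \<mu> x y =
     (\<lambda>v. \<mu> y x v - \<mu> x y v + gl_bracket (\<rho> x) (\<rho> y) v - \<rho> (br x y) v)"

locale ly_representation =
  lie_yamaguti_algebra scaleg br tr + V: vector_space scaleV
  for scaleg :: "'k::field \<Rightarrow> 'g::ab_group_add \<Rightarrow> 'g"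
    and br :: "'g \<Rightarrow> 'g \<Rightarrow> 'g"
    and tr :: "'g \<Rightarrow> 'g \<Rightarrow> 'g \<Rightarrow> 'g"
    and scaleV :: "'k \<Rightarrow> 'v::ab_group_add \<Rightarrow> 'v" +
  fixes \<rho> :: "'g \<Rightarrow> 'v \<Rightarrow> 'v"
    and \<mu> :: "'g \<Rightarrow> 'g \<Rightarrow> 'v \<Rightarrow> 'v"
  assumes rho_gl: "Vector_Spaces.linear scaleV scaleV (\<rho> x)"
    and rho_linear: "Vector_Spaces.linear scaleg scaleV (\<lambda>x. \<rho> x v)"
    and mu_gl: "Vector_Spaces.linear scaleV scaleV (\<mu> x y)"
    and mu_linear1: "Vector_Spaces.linear scaleg scaleV (\<lambda>x. \<mu> x y v)"
    and mu_linear2: "Vector_Spaces.linear scaleg scaleV (\<lambda>y. \<mu> x y v)"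
    and rep1: "\<mu> (br x y) z v - \<mu> x z (\<rho> y v) + \<mu> y z (\<rho> x v) = 0"
    and rep2: "\<mu> x (br y z) v - \<rho> y (\<mu> x z v) + \<rho> z (\<mu> x y v) = 0"
    and rep3: "\<rho> (tr x y z) v = gl_bracket (ly_D br \<rho> \<mu> x y) (\<rho> z) v"
    and rep4: "\<mu> z w (\<mu> x y v) - \<mu> y w (\<mu> x z v) - \<mu> x (tr y z w) v
                 + ly_D br \<rho> \<mu> y z (\<mu> x w v) = 0"
    and rep5: "\<mu> (tr x y z) w v + \<mu> z (tr x y w) v
                 = gl_bracket (ly_D br \<rho> \<mu> x y) (\<mu> z w) v"

definition sub_br :: "('g \<Rightarrow> 'v \<Rightarrow> 'v) \<Rightarrow> ('v \<Rightarrow> 'g) \<Rightarrow> 'v \<Rightarrow> 'v \<Rightarrow> 'v::ab_group_add" where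
  "sub_br \<rho> T u v = \<rho> (T u) v - \<rho> (T v) u"

definition sub_tr ::
  "('g \<Rightarrow> 'g \<Rightarrow> 'g) \<Rightarrow> ('g \<Rightarrow> 'v \<Rightarrow> 'v) \<Rightarrow> ('g \<Rightarrow> 'g \<Rightarrow> 'v \<Rightarrow> 'v) \<Rightarrow> ('v \<Rightarrow> 'g)
     \<Rightarrow> 'v \<Rightarrow> 'v \<Rightarrow> 'v \<Rightarrow> 'v::ab_group_add" where
  "sub_tr br \<rho> \<mu> T u v w = ly_D br \<rho> \<mu> (T u) (T v) w + \<mu> (T v) (T w) u - \<mu> (T u) (T w) v"

locale relative_rota_baxter = ly_representation scaleg br tr scaleV \<rho> \<mu>
  for scaleg :: "'k::field \<Rightarrow> 'g::ab_group_add \<Rightarrow> 'g"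
    and br :: "'g \<Rightarrow> 'g \<Rightarrow> 'g"
    and tr :: "'g \<Rightarrow> 'g \<Rightarrow> 'g \<Rightarrow> 'g"
    and scaleV :: "'k \<Rightarrow> 'v::ab_group_add \<Rightarrow> 'v"
    and \<rho> :: "'g \<Rightarrow> 'v \<Rightarrow> 'v"
    and \<mu> :: "'g \<Rightarrow> 'g \<Rightarrow> 'v \<Rightarrow> 'v" +
  fixes T :: "'v \<Rightarrow> 'g"
  assumes T_linear: "Vector_Spaces.linear scaleV scaleg T"
    and T_br: "br (T u) (T v) = T (\<rho> (T u) v - \<rho> (T v) u)"
    and T_tr: "tr (T u) (T v) (T w)
                 = T (ly_D br \<rho> \<mu> (T u) (T v) w + \<mu> (T v) (T w) u - \<mu> (T u) (T w) v)"

end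

theory Submission
  imports Defs "HOL-Library.Product_Plus"
begin

text \<open>
  Since \<open>T\<close> is a relative Rota-Baxter operator, its graph \<open>u \<mapsto> (T u, u)\<close> is a subalgebra of the
  semidirect product of \<open>'g\<close> and \<open>'v\<close>, isomorphic to the sub-adjacent algebra.  The quotient of any
  Lie-Yamaguti algebra by a subalgebra (as a vector space) is a representation of that subalgebra.
  Here the quotient is identified with \<open>'g\<close> by the projection \<open>(x, u) \<mapsto> x - T u\<close>, and the induced
  actions are \<open>rho_T\<close> and \<open>mu_T\<close>.
\<close>

section \<open>Linear maps with explicit scalar multiplications\<close>

lemma linearI_vector_space:
  assumes "vector_space s1" "vector_space s2"
    and "\<And>x y. f (x + y) = f x + f y" "\<And>c x. f (s1 c x) = s2 c (f x)"
  shows "Vector_Spaces.linear s1 s2 f"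
  using assms by (simp add: Vector_Spaces.linear_iff)

lemma linear_imp_additive:
  assumes "Vector_Spaces.linear s1 s2 f"
  shows "f (x + y) = f x + f y" "f (s1 c x) = s2 c (f x)" "f 0 = 0" "f (- x) = - f x"
    "f (x - y) = f x - f y"
proof -
  interpret Vector_Spaces.linear s1 s2 f by fact
  show "f (x + y) = f x + f y" "f (s1 c x) = s2 c (f x)" "f 0 = 0" "f (- x) = - f x"
    "f (x - y) = f x - f y"
    by (rule add scale zero neg diff)+
qed

section \<open>Subalgebras of a Lie-Yamaguti algebra and their quotient representations\<close>

context lie_yamaguti_algebra
begin

lemmas bracket_linear_simps =
  linear_imp_additive[OF br_linear1] linear_imp_additive[OF br_linear2]
  linear_imp_additive[OF tr_linear1] linear_imp_additive[OF tr_linear2]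
  linear_imp_additive[OF tr_linear3]

lemma br_antisym: "br x y = - br y x"
proof -
  have "br x y + br y x = br (x + y) (x + y)"
    unfolding bracket_linear_simps by (simp add: br_alt)
  then show ?thesis by (simp add: br_alt eq_neg_iff_add_eq_0)
qed

lemma tr_antisym: "tr x y z = - tr y x z"
proof -
  have "tr x y z + tr y x z = tr (x + y) (x + y) z"
    unfolding bracket_linear_simps by (simp add: tr_alt)
  then show ?thesis by (simp add: tr_alt eq_neg_iff_add_eq_0)
qed

text \<open>All axioms are identities, so they can be checked after applying the injective
  \<open>i\<close>. For the graph embedding this shows that the sub-adjacent brackets satisfy
  them.\<close>

lemma lie_yamaguti_algebra_pullback:
  fixes i :: "'v::ab_group_add \<Rightarrow> 'g"
  assumes i: "Vector_Spaces.linear scaleV scale i" and "inj i"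
    and br': "\<And>u v. i (brV u v) = br (i u) (i v)"
    and tr': "\<And>u v w. i (trV u v w) = tr (i u) (i v) (i w)"
  shows "lie_yamaguti_algebra scaleV brV trV"
proof -
  note isimps = linear_imp_additive[OF i] br' tr'
  have eq: "u = v" if "i u = i v" for u v
    using that \<open>inj i\<close> by (simp add: inj_eq)
  have vs: "vector_space scaleV"
    using i by (simp add: Vector_Spaces.linear_iff)
  show ?thesis
  proof (rule lie_yamaguti_algebra.intro[OF vs], rule lie_yamaguti_algebra_axioms.intro)
    fix x y z w t :: 'v
    show "Vector_Spaces.linear scaleV scaleV (\<lambda>x. brV x y)"
      "Vector_Spaces.linear scaleV scaleV (\<lambda>y. brV x y)"
      "Vector_Spaces.linear scaleV scaleV (\<lambda>x. trV x y z)"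
      "Vector_Spaces.linear scaleV scaleV (\<lambda>y. trV x y z)"
      "Vector_Spaces.linear scaleV scaleV (\<lambda>z. trV x y z)"
      by (rule linearI_vector_space[OF vs vs]; rule eq, simp add: isimps bracket_linear_simps)+
    show "brV x x = 0" "trV x x z = 0"
      by (rule eq, simp add: isimps br_alt tr_alt)+
    show "brV (brV x y) z + brV (brV y z) x + brV (brV z x) y
        + trV x y z + trV y z x + trV z x y = 0"
      by (rule eq, simp add: isimps LY1)
    show "trV (brV x y) z w + trV (brV y z) x w + trV (brV z x) y w = 0"
      by (rule eq, simp add: isimps LY2)
    show "trV x y (brV z w) = brV (trV x y z) w + brV z (trV x y w)"
      by (rule eq, simp add: isimps LY3)
    show "trV x y (trV z w t) = trV (trV x y z) w t + trV z (trV x y w) t + trV z w (trV x y t)"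
      \<comment> \<open>As a rewrite rule \<open>LY4\<close> would loop, since its last summand has
        again the form of its left side.\<close>
      by (rule eq, simp add: isimps, rule LY4)
  qed
qed

text \<open>
  The space \<open>'q\<close> plays the role of the quotient by the subalgebra \<open>range i\<close>, with projection \<open>p\<close>
  and linear section \<open>j\<close>.  Each representation axiom is the image under \<open>p\<close> of an algebra axiom
  with exactly one argument outside the subalgebra; since the subalgebra is closed under the
  brackets, that argument matters only modulo \<open>range i\<close>.
\<close>

lemma subalgebra_quotient_representation:
  fixes i :: "'v::ab_group_add \<Rightarrow> 'g" and p :: "'g \<Rightarrow> 'q::ab_group_add"
  assumes i: "Vector_Spaces.linear scaleV scale i" and "inj i"
    and br': "\<And>u v. i (brV u v) = br (i u) (i v)"
    and tr': "\<And>u v w. i (trV u v w) = tr (i u) (i v) (i w)"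
    and p: "Vector_Spaces.linear scale scaleg p"
    and j: "Vector_Spaces.linear scaleg scale j"
    and pi: "\<And>u. p (i u) = 0" and pj: "\<And>x. p (j x) = x"
    and ex: "\<And>a. p a = 0 \<Longrightarrow> a \<in> range i"
    and R: "\<And>u x. R u x = p (br (i u) (j x))"
    and M: "\<And>u v x. M u v x = p (tr (j x) (i u) (i v))"
  shows "ly_representation scaleV brV trV scaleg R M"
    and "ly_D brV R M u v x = p (tr (i u) (i v) (j x))"
proof -
  note psimps = linear_imp_additive[OF p]
  note isimps = linear_imp_additive[OF i]
  note jsimps = linear_imp_additive[OF j]
  have vsV: "vector_space scaleV" and vsg: "vector_space scaleg"
    using i p by (simp_all add: Vector_Spaces.linear_iff)
  interpret V: lie_yamaguti_algebra scaleV brV trV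
    by (rule lie_yamaguti_algebra_pullback[OF i \<open>inj i\<close> br' tr'])
  have mod: "\<exists>u. j (p a) = a + i u" for a
  proof -
    have "p (j (p a) - a) = 0" by (simp add: psimps pj)
    then obtain u where "j (p a) - a = i u" using ex by blast
    then show ?thesis by (metis add.commute diff_add_cancel)
  qed
  \<comment> \<open>Any representative may replace \<open>j (p a)\<close>: the difference lies in
    the subalgebra, as does its bracket with \<open>i u\<close>, and \<open>p\<close> kills it. This
    makes iterated actions computable.\<close>
  have R_p: "R u (p a) = p (br (i u) a)" for u a
    using mod[of a] by (auto simp: R bracket_linear_simps psimps pi br'[symmetric])
  have M_p: "M u v (p a) = p (tr a (i u) (i v))" for u v a
    using mod[of a] by (auto simp: M bracket_linear_simps psimps pi tr'[symmetric])
  have D: "ly_D brV R M u v (p a) = p (tr (i u) (i v) a)" for u v a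
  proof -
    \<comment> \<open>Antisymmetry turns every term of this instance of \<open>LY1\<close> except
      \<open>tr (i u) (i v) a\<close> into a summand of \<open>ly_D\<close>, up to sign.\<close>
    have "p (br (br (i u) (i v)) a + br (br (i v) a) (i u) + br (br a (i u)) (i v)
        + tr (i u) (i v) a + tr (i v) a (i u) + tr a (i u) (i v)) = 0"
      by (simp only: LY1 psimps)
    moreover have "br (br (i v) a) (i u) = - br (i u) (br (i v) a)" by (rule br_antisym)
    moreover have "br (br a (i u)) (i v) = br (i v) (br (i u) a)"
      by (subst br_antisym, subst br_antisym[of a]) (simp add: bracket_linear_simps)
    moreover have "tr (i v) a (i u) = - tr a (i v) (i u)" by (rule tr_antisym)
    ultimately show ?thesis
      by (simp add: ly_D_def gl_bracket_def R_p M_p psimps br' algebra_simps)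
  qed
  have D': "ly_D brV R M u v x = p (tr (i u) (i v) (j x))" for u v x
    using D[of u v "j x"] by (simp add: pj)
  show "ly_D brV R M u v x = p (tr (i u) (i v) (j x))" by (rule D')
  show "ly_representation scaleV brV trV scaleg R M"
  proof (rule ly_representation.intro[OF V.lie_yamaguti_algebra_axioms vsg],
      rule ly_representation_axioms.intro)
    fix x y z w :: 'v and v :: 'q
    note lin = R M bracket_linear_simps psimps isimps jsimps
    show "Vector_Spaces.linear scaleg scaleg (R x)"
      by (rule linearI_vector_space[OF vsg vsg]) (simp_all add: lin)
    show "Vector_Spaces.linear scaleV scaleg (\<lambda>x. R x v)"
      by (rule linearI_vector_space[OF vsV vsg]) (simp_all add: lin)
    show "Vector_Spaces.linear scaleg scaleg (M x y)"
      by (rule linearI_vector_space[OF vsg vsg]) (simp_all add: lin)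
    show "Vector_Spaces.linear scaleV scaleg (\<lambda>x. M x y v)"
      by (rule linearI_vector_space[OF vsV vsg]) (simp_all add: lin)
    show "Vector_Spaces.linear scaleV scaleg (\<lambda>y. M x y v)"
      by (rule linearI_vector_space[OF vsV vsg]) (simp_all add: lin)
    \<comment> \<open>Unfolding the actions only at \<open>v\<close> leaves each outer action
      applied to some \<open>p a\<close>, so that nested actions become \<open>p\<close> of nested
      brackets.\<close>
    note act = R[of _ v] M[of _ _ v] R_p M_p D D'[of _ _ v] gl_bracket_def br' tr'
    have flip: "br (j v) (i x) = - br (i x) (j v)" for x by (rule br_antisym)
    \<comment> \<open>The five axioms come, in order, from \<open>LY2\<close> with
      \<open>j v\<close> in third place, \<open>LY3\<close> with it first, \<open>LY3\<close> with
      it last, \<open>LY4\<close> with it first and \<open>LY4\<close> with it third.\<close>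
    show "M (brV x y) z v - M x z (R y v) + M y z (R x v) = 0"
    proof -
      have "p (tr (br (i x) (i y)) (j v) (i z) + tr (br (i y) (j v)) (i x) (i z)
          + tr (br (j v) (i x)) (i y) (i z)) = 0"
        by (simp only: LY2 psimps)
      moreover have "tr (br (i x) (i y)) (j v) (i z) = - tr (j v) (br (i x) (i y)) (i z)"
        by (rule tr_antisym)
      ultimately show ?thesis
        by (simp add: act flip bracket_linear_simps psimps algebra_simps)
    qed
    show "M x (brV y z) v - R y (M x z v) + R z (M x y v) = 0"
      using br_antisym[of "tr (j v) (i x) (i y)" "i z"]
      by (simp add: act LY3 psimps)
    show "R (trV x y z) v = gl_bracket (ly_D brV R M x y) (R z) v"
      by (simp add: act LY3 psimps)
    show "M z w (M x y v) - M y w (M x z v) - M x (trV y z w) v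
        + ly_D brV R M y z (M x w v) = 0"
      using tr_antisym[of "i y" "tr (j v) (i x) (i z)" "i w"]
      by (simp add: act LY4[of "j v" "i x" "i y" "i z" "i w"] psimps)
    show "M (trV x y z) w v + M z (trV x y w) v = gl_bracket (ly_D brV R M x y) (M z w) v"
      by (simp add: act LY4[of "i x" "i y" "j v" "i z" "i w"] psimps)
  qed
qed

end

section \<open>The semidirect product of an algebra with a representation\<close>

definition semidirect_scale ::
  "('k \<Rightarrow> 'g \<Rightarrow> 'g) \<Rightarrow> ('k \<Rightarrow> 'v \<Rightarrow> 'v) \<Rightarrow> 'k \<Rightarrow> 'g \<times> 'v \<Rightarrow> 'g \<times> 'v" where
  "semidirect_scale s1 s2 c a = (s1 c (fst a), s2 c (snd a))"

text \<open>At arguments \<open>(T u, u)\<close> the second components of this bracket and of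
  \<open>semidirect_tr\<close> are \<open>sub_br\<close> and \<open>sub_tr\<close>; the Rota-Baxter
  identities thus say that the graph of \<open>T\<close> is closed.\<close>

definition semidirect_br ::
  "('g \<Rightarrow> 'g \<Rightarrow> 'g) \<Rightarrow> ('g \<Rightarrow> 'v \<Rightarrow> 'v) \<Rightarrow> 'g \<times> 'v \<Rightarrow> 'g \<times> 'v \<Rightarrow> 'g \<times> 'v::ab_group_add" where
  "semidirect_br br \<rho> a b = (br (fst a) (fst b), \<rho> (fst a) (snd b) - \<rho> (fst b) (snd a))"

definition semidirect_tr ::
  "('g \<Rightarrow> 'g \<Rightarrow> 'g) \<Rightarrow> ('g \<Rightarrow> 'g \<Rightarrow> 'g \<Rightarrow> 'g) \<Rightarrow> ('g \<Rightarrow> 'v \<Rightarrow> 'v) \<Rightarrow> ('g \<Rightarrow> 'g \<Rightarrow> 'v \<Rightarrow> 'v)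
     \<Rightarrow> 'g \<times> 'v \<Rightarrow> 'g \<times> 'v \<Rightarrow> 'g \<times> 'v \<Rightarrow> 'g \<times> 'v::ab_group_add" where
  "semidirect_tr br tr \<rho> \<mu> a b c =
     (tr (fst a) (fst b) (fst c),
      ly_D br \<rho> \<mu> (fst a) (fst b) (snd c) + \<mu> (fst b) (fst c) (snd a) - \<mu> (fst a) (fst c) (snd b))"

lemma vector_space_semidirect_scale:
  assumes "vector_space s1" "vector_space s2"
  shows "vector_space (semidirect_scale s1 s2)"
proof -
  interpret s1: vector_space s1 by fact
  interpret s2: vector_space s2 by fact
  show ?thesis
    by unfold_locales
      (simp_all add: semidirect_scale_def prod_eq_iff s1.scale_right_distrib s1.scale_left_distrib
        s2.scale_right_distrib s2.scale_left_distrib)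
qed

context ly_representation
begin

lemmas action_linear_simps =
  linear_imp_additive[OF rho_gl] linear_imp_additive[OF rho_linear]
  linear_imp_additive[OF mu_gl] linear_imp_additive[OF mu_linear1]
  linear_imp_additive[OF mu_linear2]

abbreviation D where "D \<equiv> ly_D br \<rho> \<mu>"

lemma D_eq: "D x y v = \<mu> y x v - \<mu> x y v + (\<rho> x (\<rho> y v) - \<rho> y (\<rho> x v)) - \<rho> (br x y) v"
  by (simp add: ly_D_def gl_bracket_def)

lemma D_linear_simps:
  "D (x + x') y v = D x y v + D x' y v" "D x (y + y') v = D x y v + D x y' v"
  "D x y (v + v') = D x y v + D x y v'" "D x y (v - v') = D x y v - D x y v'"
  "D x y (- v) = - D x y v" "D x y 0 = 0"
  "D (scaleg c x) y v = scaleV c (D x y v)" "D x (scaleg c y) v = scaleV c (D x y v)"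
  "D x y (scaleV c v) = scaleV c (D x y v)"
  by (simp_all add: D_eq action_linear_simps bracket_linear_simps algebra_simps)

lemma D_alt: "D x x v = 0"
  by (simp add: D_eq br_alt action_linear_simps)

lemma mu_br_left: "\<mu> (br x y) z v = \<mu> x z (\<rho> y v) - \<mu> y z (\<rho> x v)"
  using rep1[of x y z v] by (simp add: algebra_simps)

lemma mu_br_right: "\<mu> x (br y z) v = \<rho> y (\<mu> x z v) - \<rho> z (\<mu> x y v)"
  using rep2[of x y z v] by (simp add: algebra_simps)

lemma rho_tr: "\<rho> (tr x y z) v = D x y (\<rho> z v) - \<rho> z (D x y v)"
  by (simp add: rep3 gl_bracket_def)

text \<open>Reverses \<open>rho_tr\<close>: here and in \<open>D_mu\<close>, \<open>D x y\<close>
  moves inward like a derivation.\<close>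

lemma D_rho: "D x y (\<rho> z v) = \<rho> (tr x y z) v + \<rho> z (D x y v)"
  by (simp add: rho_tr)

lemma D_mu: "D x y (\<mu> z w v) = \<mu> (tr x y z) w v + \<mu> z (tr x y w) v + \<mu> z w (D x y v)"
  by (simp add: rep5 gl_bracket_def)

lemma mu_tr_right: "\<mu> x (tr y z w) v = \<mu> z w (\<mu> x y v) - \<mu> y w (\<mu> x z v) + D y z (\<mu> x w v)"
  using rep4[of z w x y v] by (simp add: algebra_simps)

lemma rho_LY1:
  "\<rho> (br (br x y) z) v + \<rho> (br (br y z) x) v + \<rho> (br (br z x) y) v
    = - (\<rho> (tr x y z) v + \<rho> (tr y z x) v + \<rho> (tr z x y) v)"
proof -
  have "\<rho> (br (br x y) z + br (br y z) x + br (br z x) y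
                + tr x y z + tr y z x + tr z x y) v = 0"
    by (simp only: LY1 action_linear_simps)
  then show ?thesis by (simp add: action_linear_simps algebra_simps eq_neg_iff_add_eq_0)
qed

text \<open>This is what \<open>LY2\<close> demands when only its last argument lies in
  \<open>'v\<close>. \<open>rho_LY1\<close> trades double brackets for ternary ones, which
  \<open>rho_tr\<close> turns into commutators with \<open>D\<close>; the rest cancels, as in the
  Jacobi identity for operators.\<close>

lemma D_br_cyclic: "D (br x y) z v + D (br y z) x v + D (br z x) y v = 0"
proof -
  have "D (br x y) z v + D (br y z) x v + D (br z x) y v
     = (\<mu> z (br x y) v - \<mu> (br x y) z v + (\<rho> (br x y) (\<rho> z v) - \<rho> z (\<rho> (br x y) v)))
     + (\<mu> x (br y z) v - \<mu> (br y z) x v + (\<rho> (br y z) (\<rho> x v) - \<rho> x (\<rho> (br y z) v)))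
     + (\<mu> y (br z x) v - \<mu> (br z x) y v + (\<rho> (br z x) (\<rho> y v) - \<rho> y (\<rho> (br z x) v)))
     - (\<rho> (br (br x y) z) v + \<rho> (br (br y z) x) v + \<rho> (br (br z x) y) v)"
    by (simp add: D_eq)
  also have "\<dots> = 0"
    unfolding rho_LY1 rho_tr
    by (simp add: D_eq mu_br_left mu_br_right action_linear_simps)
  finally show ?thesis .
qed

text \<open>The operator \<open>D x y\<close> passes like a derivation through each summand of
  \<open>D z w\<close>; \<open>LY3\<close> accounts for the summand containing
  \<open>br z w\<close>.\<close>

lemma D_D: "D x y (D z w v) = D (tr x y z) w v + D z (tr x y w) v + D z w (D x y v)"
proof -
  have "D x y (D z w v) = D x y (\<mu> w z v) - D x y (\<mu> z w v)
      + (D x y (\<rho> z (\<rho> w v)) - D x y (\<rho> w (\<rho> z v))) - D x y (\<rho> (br z w) v)"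
    by (simp add: D_eq[of z w] D_linear_simps)
  also have "\<dots> = D (tr x y z) w v + D z (tr x y w) v + D z w (D x y v)"
    unfolding D_mu D_rho
    by (simp add: D_eq[of z w] D_eq[of "tr x y z"] D_eq[of z] LY3 action_linear_simps)
  finally show ?thesis .
qed

text \<open>The \<open>'v\<close> component of each axiom splits by which argument supplies the
  vector; the pieces are representation axioms, \<open>D_br_cyclic\<close>, \<open>D_D\<close> or
  consequences of the definition of \<open>D\<close>.\<close>

lemma lie_yamaguti_algebra_semidirect:
  "lie_yamaguti_algebra (semidirect_scale scaleg scaleV) (semidirect_br br \<rho>)
     (semidirect_tr br tr \<rho> \<mu>)"
proof -
  have vs: "vector_space (semidirect_scale scaleg scaleV)"
    by (rule vector_space_semidirect_scale) unfold_locales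
  note defs = semidirect_scale_def semidirect_br_def semidirect_tr_def prod_eq_iff
  note lin = bracket_linear_simps action_linear_simps D_linear_simps
    scale_right_diff_distrib V.scale_right_diff_distrib
    scale_right_distrib V.scale_right_distrib
  note linI = linearI_vector_space[OF vs vs]
  show ?thesis
  proof (rule lie_yamaguti_algebra.intro[OF vs], rule lie_yamaguti_algebra_axioms.intro)
    fix x y z w t :: "'g \<times> 'v"
    show "Vector_Spaces.linear (semidirect_scale scaleg scaleV) (semidirect_scale scaleg scaleV)
        (\<lambda>x. semidirect_br br \<rho> x y)" by (rule linI) (simp_all add: defs lin)
    show "Vector_Spaces.linear (semidirect_scale scaleg scaleV) (semidirect_scale scaleg scaleV)
        (\<lambda>y. semidirect_br br \<rho> x y)" by (rule linI) (simp_all add: defs lin)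
    show "semidirect_br br \<rho> x x = 0" by (simp add: defs br_alt)
    show "Vector_Spaces.linear (semidirect_scale scaleg scaleV) (semidirect_scale scaleg scaleV)
        (\<lambda>x. semidirect_tr br tr \<rho> \<mu> x y z)" by (rule linI) (simp_all add: defs lin)
    show "Vector_Spaces.linear (semidirect_scale scaleg scaleV) (semidirect_scale scaleg scaleV)
        (\<lambda>y. semidirect_tr br tr \<rho> \<mu> x y z)" by (rule linI) (simp_all add: defs lin)
    show "Vector_Spaces.linear (semidirect_scale scaleg scaleV) (semidirect_scale scaleg scaleV)
        (\<lambda>z. semidirect_tr br tr \<rho> \<mu> x y z)" by (rule linI) (simp_all add: defs lin)
    show "semidirect_tr br tr \<rho> \<mu> x x z = 0" by (simp add: defs tr_alt D_alt)
    show "semidirect_br br \<rho> (semidirect_br br \<rho> x y) z + semidirect_br br \<rho> (semidirect_br br \<rho> y z) x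
        + semidirect_br br \<rho> (semidirect_br br \<rho> z x) y + semidirect_tr br tr \<rho> \<mu> x y z
        + semidirect_tr br tr \<rho> \<mu> y z x + semidirect_tr br tr \<rho> \<mu> z x y = 0"
      \<comment> \<open>The first component is \<open>LY1\<close>; the second cancels by the
        definition of \<open>D\<close> alone.\<close>
      by (simp add: defs LY1) (simp add: D_eq action_linear_simps)
    show "semidirect_tr br tr \<rho> \<mu> (semidirect_br br \<rho> x y) z w
        + semidirect_tr br tr \<rho> \<mu> (semidirect_br br \<rho> y z) x w
        + semidirect_tr br tr \<rho> \<mu> (semidirect_br br \<rho> z x) y w = 0"
      using D_br_cyclic[of "fst x" "fst y" "fst z" "snd w"]
        LY2[of "fst x" "fst y" "fst z" "fst w"]
      by (simp add: defs mu_br_left action_linear_simps algebra_simps)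
    show "semidirect_tr br tr \<rho> \<mu> x y (semidirect_br br \<rho> z w)
        = semidirect_br br \<rho> (semidirect_tr br tr \<rho> \<mu> x y z) w
        + semidirect_br br \<rho> z (semidirect_tr br tr \<rho> \<mu> x y w)"
      by (simp add: defs LY3 mu_br_right D_rho D_linear_simps action_linear_simps)
    show "semidirect_tr br tr \<rho> \<mu> x y (semidirect_tr br tr \<rho> \<mu> z w t)
        = semidirect_tr br tr \<rho> \<mu> (semidirect_tr br tr \<rho> \<mu> x y z) w t
        + semidirect_tr br tr \<rho> \<mu> z (semidirect_tr br tr \<rho> \<mu> x y w) t
        + semidirect_tr br tr \<rho> \<mu> z w (semidirect_tr br tr \<rho> \<mu> x y t)"
      \<comment> \<open>A vector from \<open>t\<close> calls for \<open>D_D\<close>, one from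
        \<open>z\<close> or \<open>w\<close> for \<open>D_mu\<close>, and one from \<open>x\<close>
        or \<open>y\<close> for \<open>mu_tr_right\<close>.\<close>
      by (simp add: defs LY4[of "fst x" "fst y" "fst z" "fst w" "fst t"] D_D[of "fst x" "fst y" "fst z" "fst w"] D_mu[of "fst x" "fst y"]
          mu_tr_right[of _ "fst z" "fst w" "fst t"] D_linear_simps action_linear_simps)
  qed
qed

end

section \<open>The graph of \<open>T\<close> as a subalgebra of the semidirect product\<close>

theorem theorem4p13:
  fixes scaleg :: "'k::field_char_0 \<Rightarrow> 'g::ab_group_add \<Rightarrow> 'g"
    and br :: "'g \<Rightarrow> 'g \<Rightarrow> 'g"
    and tr :: "'g \<Rightarrow> 'g \<Rightarrow> 'g \<Rightarrow> 'g"
    and scaleV :: "'k \<Rightarrow> 'v::ab_group_add \<Rightarrow> 'v"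
    and \<rho> :: "'g \<Rightarrow> 'v \<Rightarrow> 'v"
    and \<mu> :: "'g \<Rightarrow> 'g \<Rightarrow> 'v \<Rightarrow> 'v"
    and T :: "'v \<Rightarrow> 'g"
    and rho_T :: "'v \<Rightarrow> 'g \<Rightarrow> 'g"
    and mu_T :: "'v \<Rightarrow> 'v \<Rightarrow> 'g \<Rightarrow> 'g"
  assumes "relative_rota_baxter scaleg br tr scaleV \<rho> \<mu> T"
    and "\<And>u x. rho_T u x = br (T u) x + T (\<rho> x u)"
    and "\<And>u v x. mu_T u v x
           = tr x (T u) (T v) - T (ly_D br \<rho> \<mu> x (T u) v - \<mu> x (T v) u)"
  shows "ly_representation scaleV (sub_br \<rho> T) (sub_tr br \<rho> \<mu> T) scaleg rho_T mu_T
       \<and> (\<forall>u v x. ly_D (sub_br \<rho> T) rho_T mu_T u v x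
            = tr (T u) (T v) x - T (\<mu> (T v) x u - \<mu> (T u) x v))"
proof -
  interpret relative_rota_baxter scaleg br tr scaleV \<rho> \<mu> T by fact
  let ?s = "semidirect_scale scaleg scaleV"
  \<comment> \<open>With \<open>(x, 0)\<close> representing \<open>x\<close>, applying
    \<open>?p\<close> to its brackets with graph elements gives exactly the formulas for
    \<open>rho_T\<close> and \<open>mu_T\<close>.\<close>
  let ?i = "\<lambda>u. (T u, u)" and ?p = "\<lambda>a. fst a - T (snd a)" and ?j = "\<lambda>x. (x, 0 :: 'v)"
  interpret S: lie_yamaguti_algebra ?s "semidirect_br br \<rho>" "semidirect_tr br tr \<rho> \<mu>"
    by (rule lie_yamaguti_algebra_semidirect)
  note Tsimps = linear_imp_additive[OF T_linear]
  note defs = semidirect_scale_def semidirect_br_def semidirect_tr_def sub_br_def sub_tr_def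
  have vsg: "vector_space scaleg" and vsV: "vector_space scaleV" and vs: "vector_space ?s"
    by unfold_locales
  have i: "Vector_Spaces.linear scaleV ?s ?i"
    by (rule linearI_vector_space[OF vsV vs]) (simp_all add: defs Tsimps)
  have p: "Vector_Spaces.linear ?s scaleg ?p"
    by (rule linearI_vector_space[OF vs vsg])
      (simp_all add: defs Tsimps scale_right_diff_distrib)
  have j: "Vector_Spaces.linear scaleg ?s ?j"
    by (rule linearI_vector_space[OF vsg vs]) (simp_all add: defs)
  have inj: "inj ?i" by (simp add: inj_def)
  have ex: "a \<in> range ?i" if "?p a = 0" for a
    using that by (cases a) auto
  note Q = S.subalgebra_quotient_representation[OF i inj _ _ p j _ _ ex,
      where brV = "sub_br \<rho> T" and trV = "sub_tr br \<rho> \<mu> T" and R = rho_T and M = mu_T]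
  have "ly_representation scaleV (sub_br \<rho> T) (sub_tr br \<rho> \<mu> T) scaleg rho_T mu_T"
    by (rule Q(1)) (simp_all add: defs T_br T_tr assms(2,3) action_linear_simps Tsimps)
  moreover have "ly_D (sub_br \<rho> T) rho_T mu_T u v x
            = ?p (semidirect_tr br tr \<rho> \<mu> (?i u) (?i v) (?j x))" for u v x
    by (rule Q(2)) (simp_all add: defs T_br T_tr assms(2,3) action_linear_simps Tsimps)
  ultimately show ?thesis
    \<comment> \<open>The \<open>D\<close> summand is evaluated at the zero component of
      \<open>?j x\<close>, so only the two \<open>\<mu>\<close> terms remain under
      \<open>T\<close>.\<close>
    by (simp add: defs D_linear_simps)
qed

end
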